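(* Let $w\geq 2$ be an even integer, let $\varepsilon\in\{1,-1\}$, let $R(X)\in\mathbb{C}[X]$ be any polynomial of degree at most $w$, and let $Z(s)$ be the unique polynomial satisfying \[\frac{R(X)}{(1-X)^{w+1}}=\sum_{n\geq 0}Z(-n)X^n .\] If $R(X)$ satisfies \[R(X)+\varepsilon i^{w}X^wR(1/X)=0,\] then \[Z(s)+\varepsilon i^wZ(1-s)=0 .\]
   Context: Here $i=\sqrt{-1}$. The identity defining $Z(s)\in\mathbb{C}[s]$ is an identity of power series in $X$ about $X=0$. The conclusion is an identity of polynomials in $s$. *)

theory Defs
  imports Complex_Main "HOL-Computational_Algebra.Polynomial_FPS"
begin

(* Division of formal power series; the divisor has constant term 1, hence is a unit. *)
definition is_zeta_poly :: "nat \<Rightarrow> complex poly \<Rightarrow> complex poly \<Rightarrow> bool" where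
  "is_zeta_poly w R Z \<longleftrightarrow>
     fps_of_poly R / (1 - fps_X) ^ (w + 1) = Abs_fps (\<lambda>n. poly Z (- of_nat n))"

end

(* Since 1/(1 - X)^(w+1) generates the binomials binom(n + w, w), the polynomial Z is
   \<Sum>k\<le>w. r_k B_k, where r_k are the coefficients of R and B_k(s) = binom(w - k - s, w).
   The generalised binomial also vanishes at the spurious points s = -n with n < k.  Negating the
   upper index gives B_(w-k)(s) = B_k(1 - s) for even w, so the reflection s \<mapsto> 1 - s of Z
   corresponds to the reversal r_k \<mapsto> r_(w-k) of R. *)
theory Submission
  imports Defs
begin

definition shifted_binomial_poly :: "nat \<Rightarrow> nat \<Rightarrow> complex poly" where
  "shifted_binomial_poly w k =
     smult (1 / fact w) (\<Prod>i<w. [:of_nat w - of_nat k - of_nat i, -1:])"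

lemma poly_shifted_binomial_poly:
  "poly (shifted_binomial_poly w k) s = (of_nat w - of_nat k - s) gchoose w"
  by (simp add: shifted_binomial_poly_def poly_prod gbinomial_prod_rev atLeast0LessThan algebra_simps)

text \<open>These values are the coefficients of X^k / (1 - X)^(w+1). The bound
  \<open>k \<le> w\<close> keeps the subtraction on naturals from truncating, so the value is 0
  exactly when n < k.\<close>

lemma poly_shifted_binomial_poly_neg_nat:
  assumes "k \<le> w"
  shows "poly (shifted_binomial_poly w k) (- of_nat n) = of_nat ((w + n - k) choose w)"
  using assms by (simp add: poly_shifted_binomial_poly binomial_gbinomial of_nat_diff algebra_simps)

lemma poly_shifted_binomial_poly_reflect:
  assumes "even w" "k \<le> w"
  shows "poly (shifted_binomial_poly w (w - k)) s = poly (shifted_binomial_poly w k) (1 - s)"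
  using assms gbinomial_negated_upper[of "of_nat k - s" w]
  by (simp add: poly_shifted_binomial_poly of_nat_diff algebra_simps)

definition zeta_poly :: "nat \<Rightarrow> complex poly \<Rightarrow> complex poly" where
  "zeta_poly w R = (\<Sum>k\<le>w. smult (coeff R k) (shifted_binomial_poly w k))"

lemma poly_zeta_poly:
  "poly (zeta_poly w R) s = (\<Sum>k\<le>w. coeff R k * poly (shifted_binomial_poly w k) s)"
  by (simp add: zeta_poly_def poly_sum)

text \<open>Cauchy product of \<open>f\<close> with the negative binomial series; the symmetry of
  binomials fixes the lower index at \<open>w\<close>, which makes each coefficient polynomial in
  \<open>n\<close>.\<close>

lemma fps_divide_one_minus_X_power_nth:
  fixes f :: "'a::field_char_0 fps"
  shows "fps_nth (f / (1 - fps_X) ^ (w + 1)) n =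
    (\<Sum>k=0..n. fps_nth f k * of_nat ((w + n - k) choose w))"
proof -
  have inv: "inverse ((1 - fps_X :: 'a fps) ^ (w + 1)) = Abs_fps (\<lambda>n. of_nat ((w + n) choose w))"
    using one_minus_const_fps_X_neg_power'[of "w + 1" "1::'a"]
      binomial_symmetric[of w "w + _"] by simp
  have "f / (1 - fps_X) ^ (w + 1) = f * inverse ((1 - fps_X) ^ (w + 1))"
    by (intro fps_divide_unit) (simp add: fps_power_zeroth)
  then show ?thesis
    unfolding inv by (auto simp: fps_mult_nth intro!: sum.cong)
qed

lemma is_zeta_poly_zeta_poly:
  assumes "degree R \<le> w"
  shows "is_zeta_poly w R (zeta_poly w R)"
proof -
  have "(\<Sum>k=0..n. coeff R k * of_nat ((w + n - k) choose w)) =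
      (\<Sum>k\<le>w. coeff R k * of_nat ((w + n - k) choose w))" for n
  proof -
    \<comment> \<open>Both ranges are compared with their intersection: terms with k > w vanish by
      the degree bound.\<close>
    have "(\<Sum>k=0..n. coeff R k * of_nat ((w + n - k) choose w)) =
        (\<Sum>k\<in>{..w} \<inter> {0..n}. coeff R k * of_nat ((w + n - k) choose w))"
      using assms by (intro sum.mono_neutral_right) (auto simp: coeff_eq_0)
    \<comment> \<open>Terms with n < k \<le> w vanish because then w + n - k < w.\<close>
    also have "\<dots> = (\<Sum>k\<le>w. coeff R k * of_nat ((w + n - k) choose w))"
      by (intro sum.mono_neutral_left) (auto simp: binomial_eq_0)
    finally show ?thesis .
  qed
  then show ?thesis
    unfolding is_zeta_poly_def fps_eq_iff fps_divide_one_minus_X_power_nth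
    by (simp add: poly_zeta_poly poly_shifted_binomial_poly_neg_nat)
qed

text \<open>In characteristic 0 the points -n are pairwise distinct, so the difference
  \<open>p - q\<close> has infinitely many roots.\<close>

lemma poly_eqI_neg_nat:
  fixes p q :: "'a::{idom,ring_char_0} poly"
  assumes "\<And>n. poly p (- of_nat n) = poly q (- of_nat n)"
  shows "p = q"
proof (rule ccontr)
  assume "p \<noteq> q"
  then have "finite {x. poly (p - q) x = 0}"
    by (intro poly_roots_finite) simp
  moreover have "range (\<lambda>n. - of_nat n :: 'a) \<subseteq> {x. poly (p - q) x = 0}"
    using assms by auto
  ultimately have "finite (range (\<lambda>n::nat. - of_nat n :: 'a))"
    by (rule rev_finite_subset)
  then show False
    by (simp add: finite_image_iff inj_on_def)
qed

lemma is_zeta_poly_unique: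
  assumes "is_zeta_poly w R Z" "is_zeta_poly w R Z'"
  shows "Z = Z'"
  using assms by (intro poly_eqI_neg_nat) (simp add: is_zeta_poly_def fps_eq_iff)

lemma coeff_functional_equation:
  fixes R :: "'a::field_char_0 poly"
  assumes deg: "degree R \<le> w" and "k \<le> w"
    and eq: "\<And>x. x \<noteq> 0 \<Longrightarrow> poly R x + c * x ^ w * poly R (1 / x) = 0"
  shows "coeff R k + c * coeff R (w - k) = 0"
proof -
  \<comment> \<open>\<open>S\<close> is the reversal of \<open>R\<close> relative to
    \<open>w\<close>. It differs from \<open>reflect_poly R\<close>, which reverses relative to the
    actual degree, possibly below \<open>w\<close>.\<close>
  define S where "S = (\<Sum>j\<le>w. monom (coeff R (w - j)) j)"
  have R: "poly R x = (\<Sum>j\<le>w. coeff R j * x ^ j)" for x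
    by (subst poly_as_sum_of_monoms'[OF deg, symmetric]) (simp add: poly_sum poly_monom)
  have "poly S x = x ^ w * poly R (1 / x)" if "x \<noteq> 0" for x
  proof -
    have "poly S x = (\<Sum>j\<le>w. coeff R j * x ^ (w - j))"
      unfolding S_def poly_sum poly_monom
      by (rule sum.reindex_bij_witness[of _ "\<lambda>j. w - j" "\<lambda>j. w - j"]) auto
    also have "\<dots> = x ^ w * poly R (1 / x)"
      unfolding R sum_distrib_left using that
      by (intro sum.cong) (auto simp: power_diff field_simps)
    finally show ?thesis .
  qed
  then have "poly (R + smult c S) x = 0" if "x \<noteq> 0" for x
    using eq[OF that] that by (simp add: mult.assoc)
  then have "- {0} \<subseteq> {x. poly (R + smult c S) x = 0}"
    by auto
  \<comment> \<open>A nonzero polynomial has finitely many roots, whereas the complement of {0} is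
    infinite.\<close>
  then have "R + smult c S = 0"
    by (metis poly_roots_finite finite_subset finite_compl finite.emptyI finite.insertI
        infinite_UNIV_char_0)
  moreover have "coeff S k = coeff R (w - k)"
    using \<open>k \<le> w\<close> by (simp add: S_def coeff_sum)
  ultimately show ?thesis
    by (metis coeff_0 coeff_add coeff_smult)
qed

lemma zeta_poly_functional_equation:
  assumes "even w" and coeffs: "\<And>k. k \<le> w \<Longrightarrow> coeff R k + c * coeff R (w - k) = 0"
  shows "zeta_poly w R + smult c (pcompose (zeta_poly w R) [:1, -1:]) = 0"
proof (rule poly_ext)
  fix s
  let ?B = "\<lambda>k. poly (shifted_binomial_poly w k)"
  have "poly (zeta_poly w R) (1 - s) = (\<Sum>k\<le>w. coeff R k * ?B (w - k) s)"
    unfolding poly_zeta_poly using \<open>even w\<close>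
    by (intro sum.cong) (simp_all add: poly_shifted_binomial_poly_reflect)
  \<comment> \<open>Reindexing moves the reversal from the basis to the coefficients, where
    \<open>coeffs\<close> makes each summand vanish.\<close>
  also have "\<dots> = (\<Sum>k\<le>w. coeff R (w - k) * ?B k s)"
    by (rule sum.reindex_bij_witness[of _ "\<lambda>k. w - k" "\<lambda>k. w - k"]) auto
  finally have "poly (zeta_poly w R) s + c * poly (zeta_poly w R) (1 - s) =
      (\<Sum>k\<le>w. (coeff R k + c * coeff R (w - k)) * ?B k s)"
    by (simp add: poly_zeta_poly sum_distrib_left sum.distrib algebra_simps)
  also have "\<dots> = 0"
    by (simp add: coeffs)
  finally show "poly (zeta_poly w R + smult c (pcompose (zeta_poly w R) [:1, -1:])) s = poly 0 s"
    by (simp add: poly_pcompose)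
qed

theorem theorem1:
  fixes w :: nat and \<epsilon> :: complex and R :: "complex poly"
  assumes "w \<ge> 2" and "even w"
    and "\<epsilon> \<in> {1, -1}"
    and "degree R \<le> w"
  shows "(\<exists>!Z. is_zeta_poly w R Z) \<and>
    (\<forall>Z. is_zeta_poly w R Z \<longrightarrow>
      (\<forall>x. x \<noteq> 0 \<longrightarrow> poly R x + \<epsilon> * \<i> ^ w * x ^ w * poly R (1 / x) = 0) \<longrightarrow>
      Z + smult (\<epsilon> * \<i> ^ w) (pcompose Z [:1, -1:]) = 0)"
proof (intro conjI allI impI)
  show "\<exists>!Z. is_zeta_poly w R Z"
    using is_zeta_poly_zeta_poly[OF \<open>degree R \<le> w\<close>] is_zeta_poly_unique by blast
next
  fix Z
  assume "is_zeta_poly w R Z"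
    and eq: "\<forall>x. x \<noteq> 0 \<longrightarrow> poly R x + \<epsilon> * \<i> ^ w * x ^ w * poly R (1 / x) = 0"
  \<comment> \<open>Uniqueness reduces an arbitrary \<open>Z\<close> to the explicit one; the
    constant \<open>c\<close> of the lemmas becomes \<open>\<epsilon> * \<i> ^ w\<close>.\<close>
  then have "Z = zeta_poly w R"
    using is_zeta_poly_zeta_poly[OF \<open>degree R \<le> w\<close>] is_zeta_poly_unique by blast
  moreover have "coeff R k + \<epsilon> * \<i> ^ w * coeff R (w - k) = 0" if "k \<le> w" for k
    using coeff_functional_equation[OF \<open>degree R \<le> w\<close> that] eq by blast
  ultimately show "Z + smult (\<epsilon> * \<i> ^ w) (pcompose Z [:1, -1:]) = 0"
    using zeta_poly_functional_equation[OF \<open>even w\<close>] by blast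
qed

end
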